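(* Let $\mathcal{A}=(Q,\Sigma,\delta)$ be a synchronizing deterministic finite automaton with $n=|Q|$ states, and let $\lambda_i$, $\rho$, $\delta_j$, $s_r$ be as defined in the context. Let $u\in\Sigma^*$ be a word of length $l$ and corank $r$ with $1\leqslant r\leqslant n/2-1$. Then there is a word of corank at least $r+1$ and length not exceeding $$l+\min\left\{\frac{(r+1)(r+2)}{2},\;2(1s_1+2s_2+3s_3+\ldots+rs_r)+2r\right\}.$$
   Context: A DFA $\mathcal{A}=(Q,\Sigma,\delta)$ has finite state set $Q$, finite alphabet $\Sigma$, total transition function $\delta:Q\times\Sigma\to Q$, extended to an action of $\Sigma^*$ on $Q$ written $q\cdot w$. The rank of a word $w$ is $|Q\cdot w|$ and its corank is $n-|Q\cdot w|$. $\mathcal{A}$ is synchronizing if some word has rank $1$. For $i\in\{0,\ldots,n-1\}$, $\lambda_i$ denotes the smallest length of a word of corank at least $i$ (so $0=\lambda_0\leqslant\cdots\leqslant\lambda_{n-1}$), and one sets $\lambda_n=+\infty$. $\rho$ is the smallest index $\rho\in\{0,\ldots,n-1\}$ with $\lambda_{\rho+1}-\lambda_\rho>n$. For $j\in\{0,\ldots,\rho\}$, $\delta_j=\lambda_{j+1}-\lambda_j$. For each positive integer $r\leqslant n/2$, $s_r$ is the number of indices $j\in\{0,\ldots,\rho\}$ with $\delta_j\in\{2r-1,2r\}$. *)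

theory Defs
  imports Complex_Main "HOL-Library.Extended_Nat"
begin

definition dfa :: "'q set \<Rightarrow> 'a set \<Rightarrow> ('q \<Rightarrow> 'a \<Rightarrow> 'q) \<Rightarrow> bool" where
  "dfa Q S \<delta> \<longleftrightarrow> finite Q \<and> finite S \<and> (\<forall>q\<in>Q. \<forall>a\<in>S. \<delta> q a \<in> Q)"

definition act :: "('q \<Rightarrow> 'a \<Rightarrow> 'q) \<Rightarrow> 'q \<Rightarrow> 'a list \<Rightarrow> 'q" where
  "act \<delta> q w = foldl \<delta> q w"

definition word_rank :: "'q set \<Rightarrow> ('q \<Rightarrow> 'a \<Rightarrow> 'q) \<Rightarrow> 'a list \<Rightarrow> nat" where
  "word_rank Q \<delta> w = card ((\<lambda>q. act \<delta> q w) ` Q)"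

definition corank :: "'q set \<Rightarrow> ('q \<Rightarrow> 'a \<Rightarrow> 'q) \<Rightarrow> 'a list \<Rightarrow> nat" where
  "corank Q \<delta> w = card Q - word_rank Q \<delta> w"

definition synchronizing :: "'q set \<Rightarrow> 'a set \<Rightarrow> ('q \<Rightarrow> 'a \<Rightarrow> 'q) \<Rightarrow> bool" where
  "synchronizing Q S \<delta> \<longleftrightarrow> (\<exists>w. set w \<subseteq> S \<and> word_rank Q \<delta> w = 1)"

definition lam :: "'q set \<Rightarrow> 'a set \<Rightarrow> ('q \<Rightarrow> 'a \<Rightarrow> 'q) \<Rightarrow> nat \<Rightarrow> enat" where
  "lam Q S \<delta> i = (if i < card Q
     then enat (LEAST l. \<exists>w. set w \<subseteq> S \<and> length w = l \<and> corank Q \<delta> w \<ge> i)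
     else \<infinity>)"

definition rho :: "'q set \<Rightarrow> 'a set \<Rightarrow> ('q \<Rightarrow> 'a \<Rightarrow> 'q) \<Rightarrow> nat" where
  "rho Q S \<delta> = (LEAST p. p < card Q \<and>
      lam Q S \<delta> (Suc p) - lam Q S \<delta> p > enat (card Q))"

definition gap :: "'q set \<Rightarrow> 'a set \<Rightarrow> ('q \<Rightarrow> 'a \<Rightarrow> 'q) \<Rightarrow> nat \<Rightarrow> enat" where
  "gap Q S \<delta> j = lam Q S \<delta> (Suc j) - lam Q S \<delta> j"

definition s_count :: "'q set \<Rightarrow> 'a set \<Rightarrow> ('q \<Rightarrow> 'a \<Rightarrow> 'q) \<Rightarrow> nat \<Rightarrow> nat" where
  "s_count Q S \<delta> r = card {j. j \<le> rho Q S \<delta> \<and>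
      gap Q S \<delta> j \<in> {enat (2*r - 1), enat (2*r)}}"

end

theory Submission
  imports Defs "HOL-Library.Function_Algebras" "HOL-Computational_Algebra.Polynomial"
begin

text \<open>For the quadratic bound, append to \<open>u\<close> a shortest word \<open>v\<close> merging two states of \<open>Q \<cdot> u\<close>
  (Frankl and Pin): along \<open>v\<close>, the complements of the successive images and the successive
  positions of the merged pair form a skew Bollobas system. For the bound in terms of the gaps,
  prepend to \<open>u\<close> a word whose image misses a state that is alone in its \<open>u\<close>-fibre; at most
  \<open>2 * r\<close> states are not alone.\<close>

section \<open>Spanning arguments\<close>

text \<open>If every inclusion failed, \<open>{a}\<close> could be enlarged for each
  \<open>j < m\<close> by a vector of \<open>G (Suc j)\<close> outside \<open>span (G j)\<close>.
  This would give \<open>m + 1\<close> independent vectors in \<open>G m\<close>, hence in the span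
  of at most \<open>m\<close> vectors.\<close>

lemma (in vector_space) span_chain_stabilizes:
  assumes mono: "\<And>k. G k \<subseteq> G (Suc k)"
    and span_B: "\<And>k. k \<le> m \<Longrightarrow> G k \<subseteq> span B"
    and B: "finite B" "card B \<le> m"
    and a: "a \<in> G 0" "a \<noteq> 0"
  shows "\<exists>j<m. G (Suc j) \<subseteq> span (G j)"
proof (rule ccontr)
  assume "\<not> ?thesis"
  then have ex: "\<exists>g. g \<in> G (Suc j) \<and> g \<notin> span (G j)" if "j < m" for j
    using that by blast
  have "\<exists>C. C \<subseteq> G k \<and> finite C \<and> independent C \<and> card C = Suc k" if "k \<le> m" for k
    using that
  proof (induction k)
    case 0
    then show ?case
      using a by (intro exI[of _ "{a}"]) auto
  next
    case (Suc k)
    then obtain C where C: "C \<subseteq> G k" "finite C" "independent C" "card C = Suc k"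
      by auto
    obtain g where g: "g \<in> G (Suc k)" "g \<notin> span (G k)"
      using ex[of k] Suc.prems by auto
    have "g \<notin> span C"
      using g(2) span_mono[OF C(1)] by auto
    moreover from this have "g \<notin> C"
      using span_base by blast
    ultimately show ?case
      using C g mono[of k] independent_insertI[of g C] by (intro exI[of _ "insert g C"]) auto
  qed
  then obtain C where "C \<subseteq> G m" "independent C" "card C = Suc m"
    by auto
  then show False
    using independent_span_bound[of B C] span_B[of m] B by auto
qed

text \<open>Scalar multiplication for real functions on an arbitrary type. Dimensions are bounded
  only through the size of a finite spanning set.\<close>

definition fscale :: "real \<Rightarrow> ('b \<Rightarrow> real) \<Rightarrow> 'b \<Rightarrow> real" where
  "fscale c f = (\<lambda>x. c * f x)"

interpretation fun_space: vector_space "fscale :: real \<Rightarrow> ('b \<Rightarrow> real) \<Rightarrow> 'b \<Rightarrow> real"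
  by unfold_locales (auto simp: fscale_def fun_eq_iff algebra_simps)

lemma sum_fun_apply: "(\<Sum>i\<in>I. f i) x = (\<Sum>i\<in>I. f i x)"
  for f :: "'i \<Rightarrow> 'b \<Rightarrow> real"
  by (induction I rule: infinite_finite_induct) auto

lemma span_lincomb:
  assumes "\<And>i. i \<in> I \<Longrightarrow> g i \<in> B"
  shows "(\<lambda>x. \<Sum>i\<in>I. c i * g i x) \<in> fun_space.span B"
proof -
  have "(\<lambda>x. \<Sum>i\<in>I. c i * g i x) = (\<Sum>i\<in>I. fscale (c i) (g i))"
    by (simp add: sum_fun_apply fscale_def fun_eq_iff)
  also have "\<dots> \<in> fun_space.span B"
  proof (rule fun_space.span_sum)
    fix i assume "i \<in> I"
    then show "fscale (c i) (g i) \<in> fun_space.span B"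
      by (rule fun_space.span_scale[OF fun_space.span_base[OF assms]])
  qed
  finally show ?thesis .
qed

text \<open>Every function in the span of those with index below \<open>k\<close> vanishes at the
  point \<open>k\<close>, while \<open>f k\<close> does not. So each index adds a dimension.\<close>

lemma triangular_card_le:
  fixes f :: "nat \<Rightarrow> nat \<Rightarrow> real"
  assumes "finite B"
    and "\<And>i. i < m \<Longrightarrow> f i \<in> fun_space.span B"
    and diag: "\<And>i. i < m \<Longrightarrow> f i i \<noteq> 0"
    and tri: "\<And>i j. i < j \<Longrightarrow> j < m \<Longrightarrow> f i j = 0"
  shows "m \<le> card B"
proof -
  have "fun_space.independent (f ` {..<k}) \<and> card (f ` {..<k}) = k" if "k \<le> m" for k
    using that
  proof (induction k)
    case (Suc k)
    have "fun_space.span (f ` {..<k}) \<subseteq> {v. v k = 0}"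
      using tri[of _ k] Suc.prems
      by (intro fun_space.span_minimal fun_space.subspaceI) (auto simp: fscale_def)
    then have "f k \<notin> fun_space.span (f ` {..<k})"
      using diag[of k] Suc.prems by auto
    moreover from this have "f k \<notin> f ` {..<k}"
      using fun_space.span_base[of "f k" "f ` {..<k}"] by argo
    ultimately show ?case
      using Suc fun_space.independent_insertI[of "f k" "f ` {..<k}"] by (simp add: lessThan_Suc)
  qed (simp add: fun_space.independent_empty)
  then have "fun_space.independent (f ` {..<m})" "card (f ` {..<m}) = m"
    by auto
  moreover have "f ` {..<m} \<subseteq> fun_space.span B"
    using assms(2) by auto
  ultimately show ?thesis
    using fun_space.independent_span_bound[of B "f ` {..<m}"] assms(1) by auto
qed

section \<open>The skew Bollobas inequality for pairs\<close>

text \<open>Folds the square of index pairs along its diagonal. For symmetric coefficients this cuts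
  \<open>(r + 1)^2\<close> monomials down to \<open>(r + 1) * (r + 2) / 2\<close>.\<close>

lemma sum_symmetric_square:
  fixes g :: "nat \<Rightarrow> nat \<Rightarrow> real"
  shows "(\<Sum>i\<le>r. \<Sum>j\<le>r. g i j) =
    (\<Sum>(i,j)\<in>(SIGMA j:{..r}. {..j}). if i = j then g i j else g i j + g j i)"
proof -
  have "(\<Sum>i\<le>r. \<Sum>j\<le>r. g i j) = (\<Sum>j\<le>r. \<Sum>i\<le>j. if j = i then g j i else g j i + g i j)"
  proof (induction r)
    case (Suc r)
    have "(\<Sum>i\<le>r. if Suc r = i then g (Suc r) i else g (Suc r) i + g i (Suc r))
       = (\<Sum>i\<le>r. g (Suc r) i + g i (Suc r))"
      by (intro sum.cong) auto
    with Suc show ?case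
      by (simp add: sum.distrib)
  qed simp
  then show ?thesis
    by (simp add: sum.Sigma)
qed

lemma card_triangle: "2 * card (SIGMA j:{..r}. {..j}) = (r + 1) * (r + 2)" for r :: nat
proof -
  have "card (SIGMA j:{..r}. {..j}) = (\<Sum>j\<le>r. Suc j)"
    by simp
  also have "2 * \<dots> = (r + 1) * (r + 2)"
    by (induction r) auto
  finally show ?thesis .
qed

lemma prod_linear_factors_expand:
  fixes A :: "real set"
  assumes "finite A"
  shows "\<exists>c. \<forall>x. (\<Prod>a\<in>A. x - a) = (\<Sum>i\<le>card A. c i * x ^ i)"
proof -
  let ?p = "\<Prod>a\<in>A. [:-a, 1:]"
  have "degree ?p = card A"
    by (subst degree_prod_sum_eq) auto
  then have "(\<Prod>a\<in>A. x - a) = (\<Sum>i\<le>card A. coeff ?p i * x ^ i)" for x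
    using poly_altdef[of ?p x] by (simp add: poly_prod)
  then show ?thesis
    by blast
qed

text \<open>The symmetric polynomial \<open>P\<^sub>A(x, y) = (\<Prod>a\<in>A. (x - a) * (y - a))\<close> vanishes exactly
  at the pairs meeting \<open>A\<close>, and it lies in a space of dimension \<open>(r + 1) * (r + 2) / 2\<close>.\<close>

lemma skew_bollobas_pairs_real:
  fixes A :: "nat \<Rightarrow> real set" and x y :: "nat \<Rightarrow> real"
  assumes fin: "\<And>i. i < m \<Longrightarrow> finite (A i)"
    and card_A: "\<And>i. i < m \<Longrightarrow> card (A i) = r"
    and disj: "\<And>i. i < m \<Longrightarrow> x i \<notin> A i \<and> y i \<notin> A i"
    and meet: "\<And>i j. i < j \<Longrightarrow> j < m \<Longrightarrow> x j \<in> A i \<or> y j \<in> A i"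
  shows "2 * m \<le> (r + 1) * (r + 2)"
proof -
  define f where "f i t = (\<Prod>a\<in>A i. x t - a) * (\<Prod>a\<in>A i. y t - a)" for i t
  define D where "D = (SIGMA j:{..r}. {..j})"
  \<comment> \<open>Symmetrised monomials suffice: the coefficient of \<open>x ^ k * y ^ l\<close>
    in \<open>f i\<close> is \<open>c k * c l\<close>, which is symmetric in \<open>k\<close> and
    \<open>l\<close>.\<close>
  define g where "g = (\<lambda>(i,j) t. if i = j then x t ^ i * y t ^ j
      else x t ^ i * y t ^ j + x t ^ j * y t ^ i)"
  have fin_D: "finite D"
    unfolding D_def by auto
  have "f i \<in> fun_space.span (g ` D)" if i: "i < m" for i
  proof -
    obtain c where c: "\<And>z. (\<Prod>a\<in>A i. z - a) = (\<Sum>k\<le>r. c k * z ^ k)"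
      using prod_linear_factors_expand[OF fin[OF i]] card_A[OF i] by auto
    have "f i t = (\<Sum>d\<in>D. (c (fst d) * c (snd d)) * g d t)" for t
    proof -
      have "f i t = (\<Sum>k\<le>r. \<Sum>l\<le>r. c k * x t ^ k * (c l * y t ^ l))"
        unfolding f_def c by (rule sum_product)
      also have "\<dots> = (\<Sum>d\<in>D. (c (fst d) * c (snd d)) * g d t)"
        unfolding sum_symmetric_square D_def g_def
        by (intro sum.cong) (auto simp: algebra_simps)
      finally show ?thesis .
    qed
    then have "f i = (\<lambda>t. \<Sum>d\<in>D. (c (fst d) * c (snd d)) * g d t)"
      by auto
    then show ?thesis
      using span_lincomb[of D g "g ` D"] by simp
  qed
  moreover have "f i i \<noteq> 0" if "i < m" for i
    using fin disj that by (auto simp: f_def)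
  moreover have "f i j = 0" if "i < j" "j < m" for i j
    using fin[of i] meet[of i j] that by (auto simp: f_def)
  ultimately have "m \<le> card (g ` D)"
    using fin_D by (intro triangular_card_le[of "g ` D" m f]) auto
  also have "\<dots> \<le> card D"
    using fin_D by (rule card_image_le)
  finally show ?thesis
    using card_triangle[of r] unfolding D_def by linarith
qed

text \<open>The hypotheses involve only membership and cardinality, and an injection of the finite
  set \<open>Q\<close> into the reals preserves both.\<close>

lemma skew_bollobas_pairs:
  fixes A :: "nat \<Rightarrow> 'b set" and x y :: "nat \<Rightarrow> 'b"
  assumes Q: "finite Q" "\<And>i. i < m \<Longrightarrow> A i \<subseteq> Q \<and> x i \<in> Q \<and> y i \<in> Q"
    and card_A: "\<And>i. i < m \<Longrightarrow> card (A i) = r"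
    and disj: "\<And>i. i < m \<Longrightarrow> x i \<notin> A i \<and> y i \<notin> A i"
    and meet: "\<And>i j. i < j \<Longrightarrow> j < m \<Longrightarrow> x j \<in> A i \<or> y j \<in> A i"
  shows "2 * m \<le> (r + 1) * (r + 2)"
proof -
  obtain h0 :: "'b \<Rightarrow> nat" where "inj_on h0 Q"
    using finite_imp_inj_to_nat_seg[OF Q(1)] by auto
  then have h: "inj_on (real \<circ> h0) Q"
    by (simp add: inj_on_def)
  let ?h = "real \<circ> h0"
  show ?thesis
  proof (rule skew_bollobas_pairs_real[where A = "\<lambda>i. ?h ` A i" and x = "?h \<circ> x" and y = "?h \<circ> y"])
    fix i assume i: "i < m"
    show "finite (?h ` A i)"
      using Q i finite_subset by blast
    show "card (?h ` A i) = r"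
      using card_image[OF inj_on_subset[OF h]] Q(2)[OF i] card_A[OF i] by simp
    show "(?h \<circ> x) i \<notin> ?h ` A i \<and> (?h \<circ> y) i \<notin> ?h ` A i"
      using disj[OF i] Q(2)[OF i] inj_on_image_mem_iff[OF h] by simp
  next
    fix i j assume "i < j" "j < m"
    then show "(?h \<circ> x) j \<in> ?h ` A i \<or> (?h \<circ> y) j \<in> ?h ` A i"
      using meet[of i j] by auto
  qed
qed

section \<open>Words acting on sets of states\<close>

lemma act_Nil [simp]: "act \<delta> q [] = q"
  by (simp add: act_def)

lemma act_append [simp]: "act \<delta> q (v @ w) = act \<delta> (act \<delta> q v) w"
  by (simp add: act_def)

lemma act_single [simp]: "act \<delta> q [a] = \<delta> q a"
  by (simp add: act_def)

locale synchronizing_dfa =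
  fixes Q :: "'q set" and S :: "'a set" and \<delta> :: "'q \<Rightarrow> 'a \<Rightarrow> 'q"
  assumes dfa: "dfa Q S \<delta>" and sync: "synchronizing Q S \<delta>"
begin

abbreviation img :: "'q set \<Rightarrow> 'a list \<Rightarrow> 'q set" where
  "img X w \<equiv> (\<lambda>q. act \<delta> q w) ` X"

lemma finite_Q [simp]: "finite Q"
  using dfa by (simp add: dfa_def)

lemma act_in_Q: "q \<in> Q \<Longrightarrow> set w \<subseteq> S \<Longrightarrow> act \<delta> q w \<in> Q"
  using dfa by (induction w rule: rev_induct) (auto simp: dfa_def)

lemma img_append: "img X (v @ w) = img (img X v) w"
  by (simp add: image_image)

lemma corank_ge_iff: "k \<le> corank Q \<delta> w \<longleftrightarrow> card (img Q w) + k \<le> card Q"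
  using card_image_le[of Q "\<lambda>q. act \<delta> q w"] by (auto simp: corank_def word_rank_def)

lemma corank_append_gt:
  assumes "set w \<subseteq> S" "set u \<subseteq> S" "img Q (w @ u) \<noteq> img Q u"
  shows "corank Q \<delta> u + 1 \<le> corank Q \<delta> (w @ u)"
proof -
  have "img Q (w @ u) \<subset> img Q u"
    using assms act_in_Q by auto
  then have "card (img Q (w @ u)) < card (img Q u)"
    by (intro psubset_card_mono) auto
  moreover have "card (img Q u) + corank Q \<delta> u \<le> card Q"
    using corank_ge_iff by blast
  ultimately show ?thesis
    by (subst corank_ge_iff) linarith
qed

lemma reset_word: obtains z q0 where "set z \<subseteq> S" "\<And>q. q \<in> Q \<Longrightarrow> act \<delta> q z = q0"
proof -
  obtain z where z: "set z \<subseteq> S" "card (img Q z) = 1"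
    using sync by (auto simp: synchronizing_def word_rank_def)
  then obtain q0 where "img Q z = {q0}"
    by (auto simp: card_1_singleton_iff)
  then have "\<And>q. q \<in> Q \<Longrightarrow> act \<delta> q z = q0"
    by blast
  with z(1) that show ?thesis
    by blast
qed

text \<open>Take \<open>v\<close> shortest among the words that shrink \<open>X\<close>. Each of its
  \<open>length v\<close> proper prefixes contributes one pair and one \<open>r\<close>-element set
  to the skew system, so the inequality for pairs bounds the length itself.\<close>

lemma short_rank_decrease:
  assumes X: "X \<subseteq> Q" "2 \<le> card X" and r: "card X + r = card Q"
  shows "\<exists>v. set v \<subseteq> S \<and> card (img X v) < card X \<and> 2 * length v \<le> (r + 1) * (r + 2)"
proof -
  have fin_X: "finite X"
    using X finite_subset finite_Q by blast
  let ?P = "\<lambda>v. set v \<subseteq> S \<and> card (img X v) < card X"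
  obtain z q0 where z: "set z \<subseteq> S" "\<And>q. q \<in> Q \<Longrightarrow> act \<delta> q z = q0"
    using reset_word by blast
  have "img X z \<subseteq> {q0}"
    using z(2) X(1) by auto
  then have "card (img X z) \<le> 1"
    using card_mono[of "{q0}" "img X z"] by simp
  then have "?P z"
    using z X by simp
  then obtain v where v: "?P v" and min: "\<And>w. ?P w \<Longrightarrow> length v \<le> length w"
    using ex_has_least_nat[of ?P z length] by auto
  have shorter_inj: "inj_on (\<lambda>q. act \<delta> q w) X" if "set w \<subseteq> S" "length w < length v" for w
  proof -
    have "\<not> card (img X w) < card X"
      using min[of w] that by auto
    then have "card (img X w) = card X"
      using card_image_le[OF fin_X, of "\<lambda>q. act \<delta> q w"] by simp
    then show ?thesis
      using eq_card_imp_inj_on fin_X by blast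
  qed
  have "\<not> inj_on (\<lambda>q. act \<delta> q v) X"
    using v card_image by fastforce
  then obtain p q where pq: "p \<in> X" "q \<in> X" "p \<noteq> q" "act \<delta> p v = act \<delta> q v"
    by (auto simp: inj_on_def)
  have take_S: "set (take i v) \<subseteq> S" and drop_S: "set (drop i v) \<subseteq> S" for i
    using v set_take_subset[of i v] set_drop_subset[of i v] by auto
  have split: "act \<delta> (act \<delta> s (take i v)) (drop i v) = act \<delta> s v" for s i
    by (metis act_append append_take_drop_id)
  have img_Q: "img X (take i v) \<subseteq> Q" for i
    using X act_in_Q take_S by blast
  have "2 * length v \<le> (r + 1) * (r + 2)"
  proof (rule skew_bollobas_pairs[where A = "\<lambda>i. Q - img X (take i v)" and Q = Q
        and x = "\<lambda>i. act \<delta> p (take i v)" and y = "\<lambda>i. act \<delta> q (take i v)"])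
    fix i assume i: "i < length v"
    show "Q - img X (take i v) \<subseteq> Q \<and> act \<delta> p (take i v) \<in> Q \<and> act \<delta> q (take i v) \<in> Q"
      using img_Q pq by blast
    have "card (img X (take i v)) = card X"
      using shorter_inj[OF take_S[of i]] i by (intro card_image) simp
    then show "card (Q - img X (take i v)) = r"
      using img_Q r by (subst card_Diff_subset) (auto simp: fin_X)
    show "act \<delta> p (take i v) \<notin> Q - img X (take i v) \<and> act \<delta> q (take i v) \<notin> Q - img X (take i v)"
      using pq by blast
  next
    fix i j assume ij: "i < j" "j < length v"
    show "act \<delta> p (take j v) \<in> Q - img X (take i v) \<or> act \<delta> q (take j v) \<in> Q - img X (take i v)"
    proof (rule ccontr)
      assume "\<not> ?thesis"
      then obtain p' q' where p'q': "p' \<in> X" "q' \<in> X"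
        "act \<delta> p (take j v) = act \<delta> p' (take i v)" "act \<delta> q (take j v) = act \<delta> q' (take i v)"
        using img_Q[of j] pq by blast
      \<comment> \<open>Skip the letters between positions \<open>i\<close> and \<open>j\<close>:
        from \<open>p'\<close> and \<open>q'\<close> the shortened word ends where \<open>v\<close>
        ends from \<open>p\<close> and \<open>q\<close>, so it merges them. Being shorter than
        \<open>v\<close> it is injective on \<open>X\<close>, hence \<open>p' = q'\<close>, and then
        \<open>p\<close> and \<open>q\<close> would already be merged at time
        \<open>j\<close>.\<close>
      let ?w = "take i v @ drop j v"
      have "inj_on (\<lambda>q. act \<delta> q ?w) X"
        using ij take_S drop_S by (intro shorter_inj) auto
      moreover have "act \<delta> p' ?w = act \<delta> q' ?w"
        using p'q' pq split by (metis act_append)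
      ultimately have "p' = q'"
        using p'q' by (auto simp only: inj_on_def)
      then have "act \<delta> p (take j v) = act \<delta> q (take j v)"
        using p'q' by simp
      moreover have "inj_on (\<lambda>q. act \<delta> q (take j v)) X"
        using ij take_S by (intro shorter_inj) auto
      ultimately show False
        using pq by (auto simp: inj_on_def)
    qed
  qed simp
  with v show ?thesis
    by blast
qed

section \<open>Avoiding a state\<close>

text \<open>The image under \<open>w\<close> of the indicator vector of \<open>X\<close>, with real
  entries so that linear algebra applies.\<close>

definition visits :: "'q set \<Rightarrow> 'a list \<Rightarrow> 'q \<Rightarrow> real" where
  "visits X w q = card {p \<in> X. act \<delta> p w = q}"

text \<open>The linear map by which the letter \<open>a\<close> moves weights along its
  transitions.\<close>

definition push :: "'a \<Rightarrow> ('q \<Rightarrow> real) \<Rightarrow> 'q \<Rightarrow> real" where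
  "push a f q = (\<Sum>s | s \<in> Q \<and> \<delta> s a = q. f s)"

lemma visits_outside: "X \<subseteq> Q \<Longrightarrow> set w \<subseteq> S \<Longrightarrow> q \<notin> Q \<Longrightarrow> visits X w q = 0"
  using act_in_Q by (auto simp: visits_def card_eq_0_iff)

lemma sum_visits:
  assumes "X \<subseteq> Q" "set w \<subseteq> S" "P \<subseteq> Q"
  shows "(\<Sum>q\<in>P. visits X w q) = card {p \<in> X. act \<delta> p w \<in> P}"
proof -
  have fin: "finite X" "finite P"
    using assms finite_subset finite_Q by blast+
  have "card {p \<in> X. act \<delta> p w \<in> P} = card (\<Union>q\<in>P. {p \<in> X. act \<delta> p w = q})"
    by (rule arg_cong[where f = card]) auto
  also have "\<dots> = (\<Sum>q\<in>P. card {p \<in> X. act \<delta> p w = q})"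
    using fin by (intro card_UN_disjoint) auto
  finally show ?thesis
    by (simp add: visits_def)
qed

lemma sum_visits_Q:
  assumes "X \<subseteq> Q" "set w \<subseteq> S"
  shows "(\<Sum>q\<in>Q. visits X w q) = card X"
proof -
  have "{p \<in> X. act \<delta> p w \<in> Q} = X"
    using assms act_in_Q by auto
  then show ?thesis
    using sum_visits[OF assms] by simp
qed

lemma push_visits:
  assumes "X \<subseteq> Q" "set w \<subseteq> S"
  shows "push a (visits X w) = visits X (w @ [a])"
proof
  fix q
  have "{p \<in> X. act \<delta> p w \<in> {s \<in> Q. \<delta> s a = q}} = {p \<in> X. act \<delta> p (w @ [a]) = q}"
    using assms act_in_Q by auto
  then show "push a (visits X w) q = visits X (w @ [a]) q"
    using sum_visits[OF assms, of "{s \<in> Q. \<delta> s a = q}"] by (simp add: push_def visits_def)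
qed

text \<open>By linearity, the vectors that \<open>push a\<close> sends into the span of
  \<open>G\<close> form a subspace. It contains \<open>G\<close>, hence the whole span.\<close>

lemma push_stable:
  assumes "\<And>g. g \<in> G \<Longrightarrow> push a g \<in> fun_space.span G" and "f \<in> fun_space.span G"
  shows "push a f \<in> fun_space.span G"
proof -
  have push_add: "push a (f + g) = push a f + push a g"
    and push_scale: "push a (fscale c f) = fscale c (push a f)"
    and push_zero: "push a 0 = 0" for f g c
    by (auto simp: push_def fscale_def fun_eq_iff sum.distrib sum_distrib_left)
  have "fun_space.span G \<subseteq> {f. push a f \<in> fun_space.span G}"
  proof (rule fun_space.span_minimal)
    show "fun_space.subspace {f. push a f \<in> fun_space.span G}"
      by (rule fun_space.subspaceI)
        (simp_all add: push_add push_scale push_zero fun_space.span_zero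
          fun_space.span_add fun_space.span_scale)
  qed (use assms(1) in blast)
  with assms(2) show ?thesis
    by blast
qed

text \<open>The vectors \<open>visits X x\<close> with \<open>x\<close> of length at most \<open>m\<close> would otherwise all be \<open>1\<close> on
  \<open>T\<close> with total mass \<open>card X\<close>. They would lie in a space of dimension at most \<open>m\<close>, so that
  their spans stabilise before length \<open>m\<close>; the vector of a reset word would then satisfy the
  same linear equations, although it is concentrated in one state.\<close>

lemma short_avoid_or_merge:
  assumes X: "X \<subseteq> Q" and T: "T \<subseteq> Q" "2 \<le> card T" and m: "card (Q - T) \<le> m" "1 \<le> m"
  shows "\<exists>x. set x \<subseteq> S \<and> length x \<le> m \<and> (card (img X x) < card X \<or> \<not> T \<subseteq> img X x)"
proof (rule ccontr)
  assume neg: "\<not> ?thesis"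
  have fin: "finite X" "finite T"
    using X T finite_subset finite_Q by blast+
  define N where "N = real (card X)"
  define G where "G k = visits X ` {x. set x \<subseteq> S \<and> length x \<le> k}" for k
  have one_on_T: "visits X x t = 1" if x: "set x \<subseteq> S" "length x \<le> m" and t: "t \<in> T" for x t
  proof -
    have "card (img X x) = card X" "T \<subseteq> img X x"
      using neg x card_image_le[OF fin(1), of "\<lambda>q. act \<delta> q x"] by (auto simp: not_less)
    then have inj: "inj_on (\<lambda>q. act \<delta> q x) X"
      using eq_card_imp_inj_on fin(1) by blast
    obtain p where p: "p \<in> X" "act \<delta> p x = t"
      using \<open>T \<subseteq> img X x\<close> t by blast
    then have "{p \<in> X. act \<delta> p x = t} = {p}"
      using inj by (auto simp: inj_on_def)
    then show ?thesis
      by (simp add: visits_def)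
  qed
  have "T \<subseteq> X"
    using neg by (auto dest!: spec[of _ "[]"])
  then have card_TX: "card T \<le> card X"
    using fin by (intro card_mono)
  have sum_rest: "(\<Sum>q\<in>Q-T. visits X x q) = N - card T" if x: "set x \<subseteq> S" "length x \<le> m" for x
  proof -
    have "(\<Sum>q\<in>T. visits X x q) = (\<Sum>q\<in>T. 1)"
      using one_on_T[OF x] by (intro sum.cong) auto
    then show ?thesis
      using sum_diff[OF finite_Q T(1), of "visits X x"] sum_visits_Q[OF X x(1)] by (simp add: N_def)
  qed
  obtain B where B: "finite B" "card B \<le> m" and G_B: "\<And>k. k \<le> m \<Longrightarrow> G k \<subseteq> fun_space.span B"
  proof (cases "card T = card X")
    \<comment> \<open>All the mass sits on \<open>T\<close>, so only the indicator of
      \<open>T\<close> occurs. It spans one dimension, which is affordable because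
      \<open>1 \<le> m\<close>.\<close>
    case True
    let ?B = "{\<lambda>q. of_bool (q \<in> T)} :: ('q \<Rightarrow> real) set"
    have "visits X x = (\<lambda>q. of_bool (q \<in> T))" if x: "set x \<subseteq> S" "length x \<le> m" for x
    proof -
      have "\<forall>q\<in>Q-T. visits X x q = 0"
        using sum_rest[OF x] True
        by (subst sum_nonneg_eq_0_iff[symmetric]) (auto simp: N_def visits_def)
      then show ?thesis
        using one_on_T[OF x] visits_outside[OF X x(1)] by (auto simp: fun_eq_iff)
    qed
    then have "G k \<subseteq> fun_space.span ?B" if "k \<le> m" for k
      using that by (auto simp: G_def fun_space.span_base)
    then show ?thesis
      using m by (intro that[of ?B]) auto
  next
    case False
    define d where "d = N - card T"
    have d: "d > 0"
      using False card_TX by (simp add: d_def N_def)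
    \<comment> \<open>The weights outside \<open>T\<close> sum to \<open>d\<close>. Spreading
      \<open>1 / d\<close> of each over all of \<open>T\<close> therefore reproduces the value
      \<open>1\<close> there, so the constant part costs no extra dimension beyond
      \<open>card (Q - T)\<close>.\<close>
    define b where "b z q = (of_bool (q = z) + of_bool (q \<in> T) / d :: real)" for z q :: 'q
    have "visits X x \<in> fun_space.span (b ` (Q - T))" if x: "set x \<subseteq> S" "length x \<le> m" for x
    proof -
      have "visits X x q = (\<Sum>z\<in>Q-T. visits X x z * b z q)" for q
      proof -
        have "(\<Sum>z\<in>Q-T. visits X x z * b z q)
            = (\<Sum>z\<in>Q-T. visits X x z * of_bool (q = z)) + (\<Sum>z\<in>Q-T. visits X x z) * (of_bool (q \<in> T) / d)"
          by (simp only: b_def distrib_left sum.distrib sum_distrib_right)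
        also have "(\<Sum>z\<in>Q-T. visits X x z * of_bool (q = z)) = (\<Sum>z\<in>Q-T. if q = z then visits X x z else 0)"
          by (intro sum.cong) auto
        also have "\<dots> = (if q \<in> Q - T then visits X x q else 0)"
          by simp
        also have "(\<Sum>z\<in>Q-T. visits X x z) = d"
          using sum_rest[OF x] by (simp add: d_def)
        finally show ?thesis
          using d one_on_T[OF x, of q] visits_outside[OF X x(1), of q] T(1) by auto
      qed
      then have "visits X x = (\<lambda>q. \<Sum>z\<in>Q-T. visits X x z * b z q)"
        by (rule ext)
      also have "\<dots> \<in> fun_space.span (b ` (Q - T))"
        by (rule span_lincomb) auto
      finally show ?thesis .
    qed
    then have "G k \<subseteq> fun_space.span (b ` (Q - T))" if "k \<le> m" for k
      using that by (auto simp: G_def)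
    moreover have "card (b ` (Q - T)) \<le> m"
      using card_image_le[of "Q - T" b] m by simp
    ultimately show ?thesis
      by (intro that[of "b ` (Q - T)"]) auto
  qed
  obtain t1 t2 where t: "t1 \<in> T" "t2 \<in> T" "t1 \<noteq> t2"
    using T(2) by (auto simp: numeral_2_eq_2 card_le_Suc_iff)
  have "visits X [] t1 = 1"
    using one_on_T[of "[]"] t by simp
  then have nonzero: "visits X [] \<noteq> 0"
    by auto
  have "\<exists>j<m. G (Suc j) \<subseteq> fun_space.span (G j)"
  proof (rule fun_space.span_chain_stabilizes)
    show "G k \<subseteq> G (Suc k)" for k
      by (auto simp: G_def)
    show "visits X [] \<in> G 0"
      by (simp add: G_def)
  qed (fact G_B B nonzero)+
  then obtain j where j: "j < m" "G (Suc j) \<subseteq> fun_space.span (G j)"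
    by blast
  have invariant: "push a g \<in> fun_space.span (G j)" if "a \<in> S" "g \<in> G j" for a g
  proof -
    obtain x where "set x \<subseteq> S" "length x \<le> j" "g = visits X x"
      using \<open>g \<in> G j\<close> by (auto simp: G_def)
    then have "push a g = visits X (x @ [a])" "set (x @ [a]) \<subseteq> S" "length (x @ [a]) \<le> Suc j"
      using \<open>a \<in> S\<close> push_visits[OF X] by auto
    then have "push a g \<in> G (Suc j)"
      unfolding G_def by blast
    then show ?thesis
      using j by blast
  qed
  have all_words: "visits X w \<in> fun_space.span (G j)" if "set w \<subseteq> S" for w
    using that
  proof (induction w rule: rev_induct)
    case Nil
    have "visits X [] \<in> G j"
      unfolding G_def by (rule imageI) simp
    then show ?case
      by (rule fun_space.span_base)
  next
    case (snoc a w)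
    then have "a \<in> S" and w: "set w \<subseteq> S" and "visits X w \<in> fun_space.span (G j)"
      by simp_all
    then have "push a (visits X w) \<in> fun_space.span (G j)"
      by (intro push_stable[OF invariant])
    then show ?case
      unfolding push_visits[OF X w] .
  qed
  \<comment> \<open>The conditions "value \<open>1\<close> on \<open>T\<close>" and "total mass
    \<open>N\<close>" are affine. Combined into one homogeneous equation per state of
    \<open>T\<close>, they define a subspace and so pass to the span.\<close>
  have "fun_space.span (G j) \<subseteq> {f. (\<forall>t\<in>T. N * f t = (\<Sum>q\<in>Q. f q))}"
  proof (rule fun_space.span_minimal)
    show "G j \<subseteq> {f. (\<forall>t\<in>T. N * f t = (\<Sum>q\<in>Q. f q))}"
      using one_on_T sum_visits_Q[OF X] j by (auto simp: G_def N_def)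
    show "fun_space.subspace {f. (\<forall>t\<in>T. N * f t = (\<Sum>q\<in>Q. f q))}"
    proof (rule fun_space.subspaceI)
      fix c f assume "f \<in> {f. (\<forall>t\<in>T. N * f t = (\<Sum>q\<in>Q. f q))}"
      then have "N * (c * f t) = c * (\<Sum>q\<in>Q. f q)" if "t \<in> T" for t
        using that by (simp add: mult.left_commute)
      then show "fscale c f \<in> {f. (\<forall>t\<in>T. N * f t = (\<Sum>q\<in>Q. f q))}"
        by (simp add: fscale_def sum_distrib_left)
    qed (auto simp: sum.distrib distrib_left)
  qed
  moreover obtain z q0 where z: "set z \<subseteq> S" "\<And>q. q \<in> Q \<Longrightarrow> act \<delta> q z = q0"
    using reset_word by blast
  ultimately have "visits X z \<in> {f. (\<forall>t\<in>T. N * f t = (\<Sum>q\<in>Q. f q))}"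
    using all_words by blast
  then have "N * visits X z t = N" if "t \<in> T" for t
    using sum_visits_Q[OF X z(1)] that unfolding N_def by auto
  moreover have "N > 0"
    using card_TX T(2) by (simp add: N_def)
  ultimately have "visits X z t = 1" if "t \<in> T" for t
    using that by fastforce
  moreover have "visits X z t = 0" if "t \<noteq> q0" for t
    using z(2) X that by (auto simp: visits_def card_eq_0_iff)
  ultimately show False
    using t by (metis zero_neq_one)
qed

section \<open>The gaps between the minimal lengths\<close>

text \<open>Agrees with \<open>lam\<close> below \<open>card Q\<close>, and keeps the arithmetic of
  lengths within the natural numbers.\<close>

definition min_len :: "nat \<Rightarrow> nat" where
  "min_len i = (LEAST l. \<exists>w. set w \<subseteq> S \<and> length w = l \<and> corank Q \<delta> w \<ge> i)"

lemma lam_eq: "i < card Q \<Longrightarrow> lam Q S \<delta> i = enat (min_len i)"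
  by (simp add: lam_def min_len_def)

lemma min_len_le: "set w \<subseteq> S \<Longrightarrow> i \<le> corank Q \<delta> w \<Longrightarrow> min_len i \<le> length w"
  unfolding min_len_def by (rule Least_le) blast

lemma min_len_0 [simp]: "min_len 0 = 0"
  using min_len_le[of "[]" 0] by simp

lemma min_len_word:
  assumes "i < card Q"
  obtains w where "set w \<subseteq> S" "length w = min_len i" "i \<le> corank Q \<delta> w"
proof -
  obtain z where z: "set z \<subseteq> S" "card (img Q z) = 1"
    using sync by (auto simp: synchronizing_def word_rank_def)
  then have "i \<le> corank Q \<delta> z"
    using assms by (simp add: corank_ge_iff)
  then have "\<exists>l w. set w \<subseteq> S \<and> length w = l \<and> corank Q \<delta> w \<ge> i"
    using z by blast
  then have "\<exists>w. set w \<subseteq> S \<and> length w = min_len i \<and> corank Q \<delta> w \<ge> i"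
    unfolding min_len_def by (rule LeastI_ex)
  then show ?thesis
    using that by blast
qed

lemma gap_eq: "Suc j < card Q \<Longrightarrow> gap Q S \<delta> j = enat (min_len (Suc j) - min_len j)"
  by (simp add: gap_def lam_eq)

text \<open>Needed because \<open>s_count\<close> sees only indices up to \<open>rho\<close>: gaps
  are counted as long as none before them exceeds \<open>card Q\<close>.\<close>

lemma le_rho:
  assumes "p < card Q" and "\<And>j. j < p \<Longrightarrow> min_len (Suc j) - min_len j \<le> card Q"
  shows "p \<le> rho Q S \<delta>"
proof -
  let ?P = "\<lambda>p. p < card Q \<and> lam Q S \<delta> (Suc p) - lam Q S \<delta> p > enat (card Q)"
  \<comment> \<open>The last gap is infinite since \<open>lam\<close> is infinite at
    \<open>card Q\<close>, so the least index defining \<open>rho\<close> exists.\<close>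
  have "?P (card Q - 1)"
    using assms(1) by (auto simp: lam_def)
  then have "?P (rho Q S \<delta>)"
    unfolding rho_def by (rule LeastI)
  moreover have "\<not> ?P j" if "j < p" for j
    using assms(2)[OF that] assms(1) that gap_eq[of j] by (simp add: gap_def)
  ultimately show ?thesis
    by (meson not_less)
qed

lemma min_len_le_sum_s_count:
  assumes p: "p < card Q" and r: "2 * r \<le> card Q"
    and small: "\<And>j. j < p \<Longrightarrow> min_len (Suc j) - min_len j \<le> 2 * r"
  shows "min_len p \<le> 2 * (\<Sum>k=1..r. k * s_count Q S \<delta> k)"
proof -
  \<comment> \<open>Half the gap, rounded up: for \<open>k \<ge> 1\<close>, \<open>c j = k\<close>
    holds exactly when the gap is \<open>2 * k - 1\<close> or \<open>2 * k\<close>, the two values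
    counted by \<open>s_count\<close> at \<open>k\<close>.\<close>
  define c where "c j = (min_len (Suc j) - min_len j + 1) div 2" for j
  \<comment> \<open>Truncated subtraction can only overestimate an increment, so monotonicity of
    \<open>min_len\<close> does not enter.\<close>
  have telescope: "min_len q \<le> 2 * (\<Sum>j<q. c j)" for q
  proof (induction q)
    case (Suc q)
    have "min_len (Suc q) \<le> min_len q + 2 * c q"
      unfolding c_def by linarith
    with Suc show ?case
      by simp
  qed simp
  have c_le: "c j \<le> r" if "j < p" for j
    using small[OF that] unfolding c_def by linarith
  have p_rho: "p \<le> rho Q S \<delta>"
    using p small r by (intro le_rho) (auto intro: order_trans)
  have "(\<Sum>j<p. c j) = (\<Sum>k=0..r. \<Sum>j\<in>{j \<in> {..<p}. c j = k}. c j)"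
    using c_le by (intro sum.group[symmetric]) auto
  also have "\<dots> = (\<Sum>k=0..r. k * card {j \<in> {..<p}. c j = k})"
    by (intro sum.cong) auto
  also have "\<dots> = (\<Sum>k=1..r. k * card {j \<in> {..<p}. c j = k})"
    by (simp add: sum.atLeast_Suc_atMost)
  also have "\<dots> \<le> (\<Sum>k=1..r. k * s_count Q S \<delta> k)"
  proof (intro sum_mono mult_le_mono2)
    fix k assume k: "k \<in> {1..r}"
    have "gap Q S \<delta> j \<in> {enat (2 * k - 1), enat (2 * k)}" if "j < p" "c j = k" for j
    proof -
      let ?d = "min_len (Suc j) - min_len j"
      have "?d = 2 * k - 1 \<or> ?d = 2 * k"
        using that(2) k unfolding c_def atLeastAtMost_iff by presburger
      then show ?thesis
        using gap_eq[of j] that p by auto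
    qed
    then have "{j \<in> {..<p}. c j = k}
        \<subseteq> {j. j \<le> rho Q S \<delta> \<and> gap Q S \<delta> j \<in> {enat (2 * k - 1), enat (2 * k)}}"
      using p_rho by auto
    then show "card {j \<in> {..<p}. c j = k} \<le> s_count Q S \<delta> k"
      unfolding s_count_def
      by (intro card_mono finite_subset[OF _ finite_atMost[of "rho Q S \<delta>"]]) auto
  qed
  finally show ?thesis
    using telescope[of p] by linarith
qed

section \<open>The two length bounds\<close>

text \<open>A fibre meeting \<open>Q - T\<close> lies in \<open>Q - T\<close> and has at least two
  elements, so \<open>Q - T\<close> has at most \<open>card (Q - T) / 2\<close> images. For a word
  of corank \<open>r\<close> this leaves at most \<open>2 * r\<close> states outside
  \<open>T\<close>.\<close>

lemma card_non_singleton_fibres: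
  fixes f :: "'q \<Rightarrow> 'c"
  assumes T: "T = {q \<in> Q. \<forall>q'\<in>Q. f q' = f q \<longrightarrow> q' = q}"
  shows "card (Q - T) + 2 * card (f ` Q) \<le> 2 * card Q"
proof -
  have T_Q: "T \<subseteq> Q"
    using T by auto
  then have fin: "finite T"
    using finite_subset finite_Q by blast
  have "2 \<le> card {q \<in> Q - T. f q = y}" if y: "y \<in> f ` (Q - T)" for y
  proof -
    obtain q where q: "q \<in> Q - T" "f q = y"
      using y by blast
    then obtain q' where "q' \<in> Q" "f q' = f q" "q' \<noteq> q"
      using T by blast
    then have "{q, q'} \<subseteq> {q \<in> Q - T. f q = y}" "card {q, q'} = 2"
      using q T by auto
    moreover have "finite {q \<in> Q - T. f q = y}"
      by simp
    ultimately show ?thesis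
      using card_mono by metis
  qed
  then have "(\<Sum>y\<in>f ` (Q - T). 2) \<le> (\<Sum>y\<in>f ` (Q - T). card {q \<in> Q - T. f q = y})"
    by (intro sum_mono) auto
  also have "\<dots> = card (Q - T)"
    using sum.image_gen[of "Q - T" "\<lambda>_. 1::nat" f] by simp
  finally have "2 * card (f ` (Q - T)) \<le> card (Q - T)"
    by simp
  moreover have "card (f ` Q) \<le> card T + card (f ` (Q - T))"
  proof -
    have "f ` Q = f ` T \<union> f ` (Q - T)"
      using T_Q by blast
    then have "card (f ` Q) \<le> card (f ` T) + card (f ` (Q - T))"
      by (simp add: card_Un_le)
    then show ?thesis
      using card_image_le[OF fin, of f] by linarith
  qed
  moreover have "card Q = card T + card (Q - T)"
    using card_Diff_subset[OF fin T_Q] card_mono[OF finite_Q T_Q] by linarith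
  ultimately show ?thesis
    by linarith
qed

lemma extend_quadratic:
  assumes u: "set u \<subseteq> S" "corank Q \<delta> u = r" and r: "2 * r + 2 \<le> card Q" "1 \<le> r"
  shows "\<exists>v. set v \<subseteq> S \<and> r + 1 \<le> corank Q \<delta> v \<and> 2 * length v \<le> 2 * length u + (r + 1) * (r + 2)"
proof -
  have "card (img Q u) + r = card Q"
    using u(2) r by (auto simp: corank_def word_rank_def)
  moreover have "img Q u \<subseteq> Q"
    using u act_in_Q by auto
  ultimately obtain v where v: "set v \<subseteq> S" "card (img (img Q u) v) < card (img Q u)"
    "2 * length v \<le> (r + 1) * (r + 2)"
    using short_rank_decrease[of "img Q u" r] r by auto
  have "r + 1 \<le> corank Q \<delta> (u @ v)"
    using v(2) \<open>card (img Q u) + r = card Q\<close> unfolding corank_ge_iff img_append by linarith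
  then show ?thesis
    using u v by (intro exI[of _ "u @ v"]) auto
qed

text \<open>Let \<open>p\<close> be the first index with a gap larger than \<open>2 * r\<close>, and \<open>w\<close> a shortest word of corank
  at least \<open>p\<close>. Words of length at most \<open>2 * r\<close> cannot merge states of \<open>Q \<cdot> w\<close>, hence one of them
  makes the image avoid a state. If there is no such \<open>p \<le> 2 * r\<close>, then corank \<open>2 * r + 1\<close> is
  reached early enough to avoid a state by counting.\<close>

lemma extend_gaps:
  assumes u: "set u \<subseteq> S" "corank Q \<delta> u = r" and r: "2 * r + 2 \<le> card Q" "1 \<le> r"
  shows "\<exists>v. set v \<subseteq> S \<and> r + 1 \<le> corank Q \<delta> v \<and>
    length v \<le> length u + (2 * (\<Sum>k=1..r. k * s_count Q S \<delta> k) + 2 * r)"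
proof -
  let ?s = "2 * (\<Sum>k=1..r. k * s_count Q S \<delta> k)"
  define T where "T = {q \<in> Q. \<forall>q'\<in>Q. act \<delta> q' u = act \<delta> q u \<longrightarrow> q' = q}"
  have T_Q: "T \<subseteq> Q"
    by (auto simp: T_def)
  have "card (img Q u) + r = card Q"
    using u(2) r by (auto simp: corank_def word_rank_def)
  then have rest: "card (Q - T) \<le> 2 * r"
    using card_non_singleton_fibres[OF T_def] by linarith
  moreover have card_Q: "card Q = card T + card (Q - T)"
    using card_Diff_subset[of T Q] finite_subset[OF T_Q finite_Q] card_mono[OF finite_Q T_Q] T_Q
    by linarith
  ultimately have T_2: "2 \<le> card T"
    using r by linarith
  \<comment> \<open>A state \<open>t\<close> of \<open>T\<close> is the only one that
    \<open>u\<close> sends to its image. If \<open>w\<close> misses \<open>t\<close>, then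
    \<open>w @ u\<close> misses the image of \<open>t\<close>, which \<open>u\<close> alone
    reaches.\<close>
  have prepend: "r + 1 \<le> corank Q \<delta> (w @ u)" if w: "set w \<subseteq> S" "\<not> T \<subseteq> img Q w" for w
  proof -
    obtain t where t: "t \<in> T" "t \<notin> img Q w"
      using w by blast
    have "act \<delta> t u \<notin> img Q (w @ u)"
    proof
      assume "act \<delta> t u \<in> img Q (w @ u)"
      then obtain q where q: "q \<in> Q" "act \<delta> (act \<delta> q w) u = act \<delta> t u"
        by auto
      then have "act \<delta> q w = t"
        using t(1) act_in_Q[OF q(1) w(1)] unfolding T_def by blast
      then show False
        using t(2) q(1) by blast
    qed
    moreover have "act \<delta> t u \<in> img Q u"
      using t T_Q by blast
    ultimately show ?thesis
      using corank_append_gt[OF w(1) u(1)] u(2) by metis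
  qed
  have "\<exists>w. set w \<subseteq> S \<and> \<not> T \<subseteq> img Q w \<and> length w \<le> ?s + 2 * r"
  proof (cases "\<exists>p\<le>2 * r. 2 * r < min_len (Suc p) - min_len p")
    case True
    then obtain p where p: "p \<le> 2 * r" "2 * r < min_len (Suc p) - min_len p"
      and least: "\<And>j. j < p \<Longrightarrow> \<not> (j \<le> 2 * r \<and> 2 * r < min_len (Suc j) - min_len j)"
      using exists_least_iff[of "\<lambda>p. p \<le> 2 * r \<and> 2 * r < min_len (Suc p) - min_len p"] by auto
    have small: "min_len (Suc j) - min_len j \<le> 2 * r" if "j < p" for j
      using least[OF that] p(1) that by linarith
    have len: "min_len p \<le> ?s"
      using p r small by (intro min_len_le_sum_s_count) auto
    have "p < card Q"
      using p(1) r by linarith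
    then obtain w where w: "set w \<subseteq> S" "length w = min_len p" "p \<le> corank Q \<delta> w"
      using min_len_word by blast
    have img_w: "img Q w \<subseteq> Q"
      using w act_in_Q by auto
    have "1 \<le> 2 * r"
      using r by linarith
    then obtain x where x: "set x \<subseteq> S" "length x \<le> 2 * r"
      "card (img (img Q w) x) < card (img Q w) \<or> \<not> T \<subseteq> img (img Q w) x"
      using short_avoid_or_merge[OF img_w T_Q T_2 rest] by blast
    \<comment> \<open>A merge would give corank \<open>p + 1\<close> within length
      \<open>min_len p + 2 * r\<close>, against the choice of \<open>p\<close>.\<close>
    have "\<not> card (img (img Q w) x) < card (img Q w)"
    proof
      assume "card (img (img Q w) x) < card (img Q w)"
      then have "Suc p \<le> corank Q \<delta> (w @ x)"
        using w(3) unfolding corank_ge_iff img_append by linarith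
      then have "min_len (Suc p) \<le> length (w @ x)"
        using w x by (intro min_len_le) auto
      then show False
        using w x p by simp
    qed
    then have "\<not> T \<subseteq> img Q (w @ x)"
      using x(3) unfolding img_append by blast
    then show ?thesis
      using w x len by (intro exI[of _ "w @ x"]) auto
  next
    case False
    have "2 * r + 1 < card Q"
      using r by linarith
    then obtain w where w: "set w \<subseteq> S" "length w = min_len (2 * r + 1)" "2 * r + 1 \<le> corank Q \<delta> w"
      using min_len_word by blast
    have "min_len (2 * r + 1) \<le> ?s"
      using False r by (intro min_len_le_sum_s_count) (auto simp: not_less)
    \<comment> \<open>The image of \<open>w\<close> has at most \<open>card Q - 2 * r - 1\<close>
      states, while \<open>T\<close> has at least \<open>card Q - 2 * r\<close>.\<close>
    moreover have "\<not> T \<subseteq> img Q w"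
    proof
      assume "T \<subseteq> img Q w"
      then have "card T \<le> card (img Q w)"
        by (intro card_mono) auto
      then show False
        using w(3) rest card_Q by (simp add: corank_ge_iff)
    qed
    ultimately show ?thesis
      using w by (intro exI[of _ w]) auto
  qed
  then obtain w where "set w \<subseteq> S" "\<not> T \<subseteq> img Q w" "length w \<le> ?s + 2 * r"
    by blast
  then show ?thesis
    using prepend u by (intro exI[of _ "w @ u"]) auto
qed

end

theorem theorem5:
  fixes Q :: "'q set" and S :: "'a set" and \<delta> :: "'q \<Rightarrow> 'a \<Rightarrow> 'q"
    and u :: "'a list" and r :: nat
  assumes "dfa Q S \<delta>"
    and "synchronizing Q S \<delta>"
    and "set u \<subseteq> S"
    and "corank Q \<delta> u = r"
    and "1 \<le> r"
    and "real r \<le> real (card Q) / 2 - 1"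
  shows "\<exists>v. set v \<subseteq> S \<and> corank Q \<delta> v \<ge> r + 1 \<and>
           real (length v) \<le> real (length u) +
             min (real ((r + 1) * (r + 2)) / 2)
                 (real (2 * (\<Sum>k=1..r. k * s_count Q S \<delta> k) + 2 * r))"
proof -
  interpret synchronizing_dfa Q S \<delta>
    using assms(1,2) by unfold_locales
  have r: "2 * r + 2 \<le> card Q"
    using assms(6) by linarith
  obtain v1 where v1: "set v1 \<subseteq> S" "r + 1 \<le> corank Q \<delta> v1"
    "2 * length v1 \<le> 2 * length u + (r + 1) * (r + 2)"
    using extend_quadratic[OF assms(3,4) r assms(5)] by blast
  obtain v2 where v2: "set v2 \<subseteq> S" "r + 1 \<le> corank Q \<delta> v2"
    "length v2 \<le> length u + (2 * (\<Sum>k=1..r. k * s_count Q S \<delta> k) + 2 * r)"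
    using extend_gaps[OF assms(3,4) r assms(5)] by blast
  have "real (length v1) \<le> real (length u) + real ((r + 1) * (r + 2)) / 2"
    using v1(3) by linarith
  moreover have "real (length v2) \<le> real (length u) + real (2 * (\<Sum>k=1..r. k * s_count Q S \<delta> k) + 2 * r)"
    using v2(3) by linarith
  ultimately show ?thesis
    using v1(1,2) v2(1,2) unfolding min_def by (auto simp only: split: if_split)
qed

end
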